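(* Let $\mu$ be a finite Borel measure on $\mathbb{R}^d$, let $A,B$ be positive constants, and let $1<p,q<\infty$ with $\frac1p+\frac1q=1$. Then both sets $\mathcal{B}_B(\mu)_{p,q}$ and $\mathcal{F}_{A,B}(\mu)_{p,q}$ are convex and closed under convolution with Borel probability measures on $\mathbb{R}^d$.
   Context: For $t\in\mathbb{R}^d$ let $e_t(x)=e^{2\pi i t\cdot x}$. For a finite Borel measure $\mu$ on $\mathbb{R}^d$ and $1<p<\infty$, the compatible semi-inner product on $L^p(\mu)$ is $$[f,g]_{L^p(\mu)}=\frac{1}{\|g\|_{L^p(\mu)}^{p-2}}\int f(x)\,|g(x)|^{p-1}\,\overline{\mathrm{sgn}(g(x))}\,d\mu(x)$$ if $\|g\|_{L^p(\mu)}\neq0$, and $0$ otherwise (where $\mathrm{sgn}(z)=z/|z|$ for $z\ne0$, $\mathrm{sgn}(0)=0$). Let $1<p,q<\infty$ be conjugate exponents. $\mathcal{B}_B(\mu)_{p,q}$ is the set of all Borel measures $\nu$ on $\mathbb{R}^d$ with $\int_{\mathbb{R}^d}|[f,e_t]_{L^p(\mu)}|^q\,d\nu(t)\le B\|f\|_{L^p(\mu)}^q$ for all $f\in L^p(\mu)$ (the $(p,q)$-Bessel measures for $\mu$ with bound $B$). $\mathcal{F}_{A,B}(\mu)_{p,q}$ is the set of all Borel measures $\nu$ with $A\|f\|_{L^p(\mu)}^q\le\int_{\mathbb{R}^d}|[f,e_t]_{L^p(\mu)}|^q\,d\nu(t)\le B\|f\|_{L^p(\mu)}^q$ for all $f\in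 L^p(\mu)$ (the $(p,q)$-frame measures for $\mu$ with bounds $A,B$). The convolution is $(\nu*\rho)(E)=\iint\chi_E(x+y)\,d\nu(x)\,d\rho(y)$. *)

theory Defs
  imports "HOL-Probability.Probability"
begin

definition expo :: "(real ^ 'd) \<Rightarrow> (real ^ 'd) \<Rightarrow> complex" where
  "expo t x = exp (2 * complex_of_real pi * \<i> * complex_of_real (t \<bullet> x))"

(* Elements of L^p are represented by functions, not by classes modulo null sets;
   the norm and the semi-inner product below depend only on the class. *)
definition Lp_space :: "real \<Rightarrow> 'a measure \<Rightarrow> ('a \<Rightarrow> complex) set" where
  "Lp_space p M = {f \<in> borel_measurable M. integrable M (\<lambda>x. norm (f x) powr p)}"

definition Lp_norm :: "real \<Rightarrow> 'a measure \<Rightarrow> ('a \<Rightarrow> complex) \<Rightarrow> real" where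
  "Lp_norm p M f = (\<integral>x. norm (f x) powr p \<partial>M) powr (1 / p)"

definition Lp_semi_inner ::
    "real \<Rightarrow> 'a measure \<Rightarrow> ('a \<Rightarrow> complex) \<Rightarrow> ('a \<Rightarrow> complex) \<Rightarrow> complex" where
  "Lp_semi_inner p M f g =
    (if Lp_norm p M g \<noteq> 0
     then complex_of_real (1 / Lp_norm p M g powr (p - 2)) *
          (\<integral>x. f x * complex_of_real (norm (g x) powr (p - 1)) * cnj (sgn (g x)) \<partial>M)
     else 0)"

definition bessel_measures ::
    "real \<Rightarrow> (real ^ 'd) measure \<Rightarrow> real \<Rightarrow> real \<Rightarrow> (real ^ 'd) measure set" where
  "bessel_measures B \<mu> p q = {\<nu>. sets \<nu> = sets borel \<and>
    (\<forall>f \<in> Lp_space p \<mu>.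
      (\<integral>\<^sup>+ t. ennreal (norm (Lp_semi_inner p \<mu> f (expo t)) powr q) \<partial>\<nu>)
        \<le> ennreal (B * Lp_norm p \<mu> f powr q))}"

definition frame_measures ::
    "real \<Rightarrow> real \<Rightarrow> (real ^ 'd) measure \<Rightarrow> real \<Rightarrow> real \<Rightarrow> (real ^ 'd) measure set" where
  "frame_measures A B \<mu> p q = {\<nu>. sets \<nu> = sets borel \<and>
    (\<forall>f \<in> Lp_space p \<mu>.
      ennreal (A * Lp_norm p \<mu> f powr q)
        \<le> (\<integral>\<^sup>+ t. ennreal (norm (Lp_semi_inner p \<mu> f (expo t)) powr q) \<partial>\<nu>) \<and>
      (\<integral>\<^sup>+ t. ennreal (norm (Lp_semi_inner p \<mu> f (expo t)) powr q) \<partial>\<nu>)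
        \<le> ennreal (B * Lp_norm p \<mu> f powr q))}"

(* The measure s M + (1 - s) N, for M and N on the same sigma-algebra and 0 \<le> s \<le> 1. *)
definition convex_comb_measure :: "real \<Rightarrow> 'a measure \<Rightarrow> 'a measure \<Rightarrow> 'a measure" where
  "convex_comb_measure s M N =
    measure_of (space M) (sets M) (\<lambda>E. ennreal s * emeasure M E + ennreal (1 - s) * emeasure N E)"

lemma sets_convex_comb_measure [simp]: "sets (convex_comb_measure s M N) = sets M"
  by (simp add: convex_comb_measure_def)

lemma emeasure_convex_comb_measure:
  assumes "sets N = sets M" "E \<in> sets M"
  shows "emeasure (convex_comb_measure s M N) E
           = ennreal s * emeasure M E + ennreal (1 - s) * emeasure N E"
  using convex_comb_measure_def
proof (rule emeasure_measure_of)
  show "sets M \<subseteq> Pow (space M)"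
    by (rule sets.space_closed)
  show "E \<in> sets (convex_comb_measure s M N)"
    using assms by simp
  show "positive (sets (convex_comb_measure s M N))
          (\<lambda>E. ennreal s * emeasure M E + ennreal (1 - s) * emeasure N E)"
    by (simp add: positive_def)
  show "countably_additive (sets (convex_comb_measure s M N))
          (\<lambda>E. ennreal s * emeasure M E + ennreal (1 - s) * emeasure N E)"
  proof (rule countably_additiveI)
    fix F :: "nat \<Rightarrow> 'a set"
    assume F: "range F \<subseteq> sets (convex_comb_measure s M N)" "disjoint_family F"
    then have "range F \<subseteq> sets M" "range F \<subseteq> sets N"
      using assms by auto
    with F show "(\<Sum>i. ennreal s * emeasure M (F i) + ennreal (1 - s) * emeasure N (F i))
        = ennreal s * emeasure M (\<Union>i. F i) + ennreal (1 - s) * emeasure N (\<Union>i. F i)"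
      by (simp add: suminf_add [symmetric] suminf_emeasure)
  qed
qed

definition convex_measure_set :: "'a measure set \<Rightarrow> bool" where
  "convex_measure_set S \<longleftrightarrow>
    (\<forall>\<nu>1 \<in> S. \<forall>\<nu>2 \<in> S. \<forall>s. 0 \<le> s \<and> s \<le> 1 \<longrightarrow> convex_comb_measure s \<nu>1 \<nu>2 \<in> S)"

definition closed_under_prob_convolution :: "(real ^ 'd) measure set \<Rightarrow> bool" where
  "closed_under_prob_convolution S \<longleftrightarrow>
    (\<forall>\<nu> \<in> S. \<forall>\<rho>. prob_space \<rho> \<and> sets \<rho> = sets borel \<longrightarrow> (\<nu> \<star> \<rho>) \<in> S)"

(* The library convolution integrates over the second factor first. For sigma-finite measures
   the order is immaterial, and when \<mu> is finite and nonzero every Bessel measure for \<mu> is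
   locally finite, hence sigma-finite. *)
lemma emeasure_convolution_swap:
  fixes \<nu> \<rho> :: "(real ^ 'd) measure"
  assumes "sigma_finite_measure \<nu>" "prob_space \<rho>"
    and [measurable_cong]: "sets \<nu> = sets borel" "sets \<rho> = sets borel"
    and [measurable]: "E \<in> sets borel"
  shows "emeasure (\<nu> \<star> \<rho>) E = (\<integral>\<^sup>+ y. \<integral>\<^sup>+ x. indicator E (x + y) \<partial>\<nu> \<partial>\<rho>)"
proof -
  interpret N: sigma_finite_measure \<nu> by fact
  interpret R: prob_space \<rho> by fact
  interpret pair_sigma_finite \<nu> \<rho> ..
  have "emeasure (\<nu> \<star> \<rho>) E = (\<integral>\<^sup>+ z. indicator E z \<partial>(\<nu> \<star> \<rho>))"
    by simp
  also have "\<dots> = (\<integral>\<^sup>+ z. indicator E (fst z + snd z) \<partial>(\<nu> \<Otimes>\<^sub>M \<rho>))"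
    unfolding convolution_def
    by (subst nn_integral_distr) (simp_all add: case_prod_beta)
  also have "\<dots> = (\<integral>\<^sup>+ y. \<integral>\<^sup>+ x. indicator E (x + y) \<partial>\<nu> \<partial>\<rho>)"
    by (subst nn_integral_snd [symmetric]) (simp_all add: case_prod_beta)
  finally show ?thesis .
qed

end

theory Submission
  imports Defs
begin

text \<open>
  Translating the frequency \<open>t\<close> of a pairing \<open>[f, e\<^sub>t]\<close> amounts to modulating \<open>f\<close>: since
  \<open>e\<^sub>t\<close> is unimodular and \<open>e\<^bsub>t + y\<^esub> = e\<^sub>t e\<^sub>y\<close>, we have \<open>[f, e\<^bsub>t + y\<^esub>] = [f e\<^bsub>- y\<^esub>, e\<^sub>t]\<close>,
  and multiplication by \<open>e\<^bsub>- y\<^esub>\<close> is an isometry of \<open>L\<^sup>p(\<mu>)\<close>. Tonelli's theorem therefore turns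
  the frame integral of \<open>f\<close> against \<open>\<nu> \<star> \<rho>\<close> into the \<open>\<rho>\<close>-average, over \<open>y\<close>, of the frame
  integrals of \<open>f e\<^bsub>- y\<^esub>\<close> against \<open>\<nu>\<close>. All of these obey the same bounds, and \<open>\<rho>\<close> has mass one.

  Tonelli's theorem needs \<open>\<nu>\<close> to be \<open>\<sigma>\<close>-finite, which is a consequence of the Bessel inequality
  when \<open>\<mu> \<noteq> 0\<close>. The pairing \<open>[e\<^sub>s, e\<^sub>t]\<close> is a constant multiple of the Fourier transform of
  \<open>\<mu>\<close> at \<open>t - s\<close>, which is continuous and does not vanish at the origin; testing the
  inequality on \<open>e\<^sub>s\<close> bounds the \<open>\<nu>\<close>-mass of a ball around \<open>s\<close> whose radius does not depend on
  \<open>s\<close>. When \<open>\<mu> = 0\<close> all pairings vanish and no integral has to be interchanged.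

  Convexity holds because the frame integral is an affine function of the measure \<open>\<nu>\<close>.
\<close>

section \<open>Characters and modulation\<close>

lemma expo_eq_cis: "expo t x = cis (2 * pi * (t \<bullet> x))"
  by (simp add: expo_def cis_conv_exp mult_ac)

lemma norm_expo [simp]: "norm (expo t x) = 1"
  by (simp add: expo_eq_cis)

lemma sgn_expo [simp]: "sgn (expo t x) = expo t x"
  by (simp add: sgn_eq)

lemma expo_0 [simp]: "expo 0 x = 1"
  by (simp add: expo_eq_cis)

lemma expo_add: "expo (s + t) x = expo s x * expo t x"
  by (simp add: expo_eq_cis cis_mult inner_add_left algebra_simps)

lemma cnj_expo: "cnj (expo t x) = expo (- t) x"
  by (simp add: expo_eq_cis cis_cnj)

lemma measurable_expo [measurable (raw)]:
  assumes "f \<in> borel_measurable M" "g \<in> borel_measurable M"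
  shows "(\<lambda>x. expo (f x) (g x)) \<in> borel_measurable M"
  using assms unfolding expo_def by measurable

lemma Lp_norm_expo: "Lp_norm p M (expo t) = measure M (space M) powr (1 / p)"
  by (simp add: Lp_norm_def)

lemma Lp_norm_modulate: "Lp_norm p M (\<lambda>x. f x * expo s x) = Lp_norm p M f"
  by (simp add: Lp_norm_def norm_mult)

lemma Lp_space_modulate:
  assumes [measurable_cong]: "sets M = sets borel" and "f \<in> Lp_space p M"
  shows "(\<lambda>x. f x * expo s x) \<in> Lp_space p M"
proof -
  have [measurable]: "f \<in> borel_measurable M"
    using assms(2) by (simp add: Lp_space_def)
  have "(\<lambda>x. f x * expo s x) \<in> borel_measurable M"
    by measurable
  then show ?thesis
    using assms(2) by (simp add: Lp_space_def norm_mult)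
qed

lemma expo_in_Lp_space:
  assumes "finite_measure M" and [measurable_cong]: "sets M = sets borel"
  shows "expo s \<in> Lp_space p M"
proof -
  interpret finite_measure M by fact
  have "expo s \<in> borel_measurable M"
    by measurable
  then show ?thesis
    by (simp add: Lp_space_def)
qed

text \<open>
  The characters all have the norm of \<open>e\<^sub>0 = 1\<close>, so that the normalising factor does not depend
  on \<open>t\<close>, and the pairing with \<open>e\<^sub>t\<close> is a constant multiple of a Fourier coefficient.
\<close>

lemma Lp_semi_inner_expo:
  "Lp_semi_inner p M f (expo t) =
    (if Lp_norm p M (expo 0) \<noteq> 0
     then complex_of_real (1 / Lp_norm p M (expo 0) powr (p - 2)) * (\<integral>x. f x * expo (- t) x \<partial>M)
     else 0)"
  by (simp add: Lp_semi_inner_def Lp_norm_expo cnj_expo)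

lemma Lp_semi_inner_expo_add:
  "Lp_semi_inner p M f (expo (t + y)) = Lp_semi_inner p M (\<lambda>x. f x * expo (- y) x) (expo t)"
  using expo_add[of "- t" "- y"] by (simp add: Lp_semi_inner_expo mult_ac)

text \<open>
  The pairing is a parameter integral whose integrand is jointly measurable in \<open>(t, x)\<close>.
\<close>

lemma measurable_Lp_semi_inner_expo:
  assumes "finite_measure M" and [measurable_cong]: "sets M = sets borel"
    and [measurable]: "f \<in> borel_measurable M"
  shows "(\<lambda>t. Lp_semi_inner p M f (expo t)) \<in> borel_measurable borel"
proof -
  interpret finite_measure M by fact
  have "(\<lambda>t. \<integral>x. f x * expo (- t) x \<partial>M) \<in> borel_measurable borel"
    by measurable
  then show ?thesis
    unfolding Lp_semi_inner_expo by simp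
qed

section \<open>The frame integral\<close>

definition frame_integral ::
    "real \<Rightarrow> real \<Rightarrow> (real ^ 'd) measure \<Rightarrow> (real ^ 'd) measure \<Rightarrow> (real ^ 'd \<Rightarrow> complex) \<Rightarrow> ennreal"
  where "frame_integral p q \<mu> \<nu> f =
    (\<integral>\<^sup>+ t. ennreal (norm (Lp_semi_inner p \<mu> f (expo t)) powr q) \<partial>\<nu>)"

lemma bessel_measures_iff:
  "\<nu> \<in> bessel_measures B \<mu> p q \<longleftrightarrow> sets \<nu> = sets borel \<and>
    (\<forall>f \<in> Lp_space p \<mu>. frame_integral p q \<mu> \<nu> f \<le> ennreal (B * Lp_norm p \<mu> f powr q))"
  by (simp add: bessel_measures_def frame_integral_def)

lemma frame_measures_iff:
  "\<nu> \<in> frame_measures A B \<mu> p q \<longleftrightarrow> \<nu> \<in> bessel_measures B \<mu> p q \<and>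
    (\<forall>f \<in> Lp_space p \<mu>. ennreal (A * Lp_norm p \<mu> f powr q) \<le> frame_integral p q \<mu> \<nu> f)"
  by (auto simp: frame_measures_def bessel_measures_def frame_integral_def)

lemma measurable_frame_integrand:
  assumes "finite_measure \<mu>" "sets \<mu> = sets borel" "f \<in> Lp_space p \<mu>"
  shows "(\<lambda>t. ennreal (norm (Lp_semi_inner p \<mu> f (expo t)) powr q)) \<in> borel_measurable borel"
proof -
  have [measurable]: "(\<lambda>t. Lp_semi_inner p \<mu> f (expo t)) \<in> borel_measurable borel"
    using assms by (intro measurable_Lp_semi_inner_expo) (auto simp: Lp_space_def)
  show ?thesis
    by measurable
qed

section \<open>Convex combinations\<close>

lemma nn_integral_convex_comb_measure:
  assumes sets: "sets N = sets M" and f: "f \<in> borel_measurable M"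
  shows "(\<integral>\<^sup>+ x. f x \<partial>convex_comb_measure s M N)
    = ennreal s * (\<integral>\<^sup>+ x. f x \<partial>M) + ennreal (1 - s) * (\<integral>\<^sup>+ x. f x \<partial>N)"
proof -
  let ?C = "convex_comb_measure s M N"
  have C: "sets ?C = sets M" "space ?C = space M" "space N = space M"
    using sets sets_eq_imp_space_eq[of ?C M] sets_eq_imp_space_eq[of N M] by simp_all
  have mC: "g \<in> borel_measurable ?C" and mN: "g \<in> borel_measurable N"
    if "g \<in> borel_measurable M" for g :: "'a \<Rightarrow> ennreal"
    using that measurable_cong_sets[OF C(1) refl] measurable_cong_sets[OF sets refl] by auto
  show ?thesis
    using f
  proof (induction rule: borel_measurable_induct)
    case (cong f g)
    have "(\<integral>\<^sup>+ x. f x \<partial>K) = (\<integral>\<^sup>+ x. g x \<partial>K)" if "space K = space M" for K :: "'a measure"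
      using cong that by (intro nn_integral_cong) auto
    then show ?case
      using cong C by simp
  next
    case (set E)
    then show ?case
      using sets C by (simp add: emeasure_convex_comb_measure)
  next
    case (mult u c)
    then show ?case
      by (simp add: nn_integral_cmult mC mN distrib_left mult_ac)
  next
    case (add u v)
    then show ?case
      by (simp add: nn_integral_add mC mN distrib_left add_ac)
  next
    case (seq U)
    have lim: "(\<integral>\<^sup>+ x. (SUP i. U i) x \<partial>K) = (SUP i. \<integral>\<^sup>+ x. U i x \<partial>K)"
      if "\<And>i. U i \<in> borel_measurable K" for K :: "'a measure"
      unfolding SUP_apply using seq that by (intro nn_integral_monotone_convergence_SUP) auto
    have mono: "incseq (\<lambda>i. c * (\<integral>\<^sup>+ x. U i x \<partial>K))" for c and K :: "'a measure"
      using seq(3) by (auto simp: mono_def le_fun_def intro!: mult_left_mono nn_integral_mono)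
    show ?case
      using seq by (simp add: lim mC mN SUP_mult_left_ennreal ennreal_SUP_add mono del: Sup_apply SUP_apply)
  qed
qed

lemma frame_integral_convex_comb_measure:
  assumes "finite_measure \<mu>" "sets \<mu> = sets borel" "f \<in> Lp_space p \<mu>"
    and "sets \<nu>1 = sets borel" "sets \<nu>2 = sets borel"
  shows "frame_integral p q \<mu> (convex_comb_measure s \<nu>1 \<nu>2) f
    = ennreal s * frame_integral p q \<mu> \<nu>1 f + ennreal (1 - s) * frame_integral p q \<mu> \<nu>2 f"
  unfolding frame_integral_def
  using assms measurable_frame_integrand[OF assms(1-3), of q]
  by (intro nn_integral_convex_comb_measure) (auto simp: measurable_cong_sets[OF assms(4) refl])

lemma ennreal_convex_comb_same:
  assumes "0 \<le> s" "s \<le> 1"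
  shows "ennreal s * c + ennreal (1 - s) * c = c"
  using assms by (simp flip: distrib_right ennreal_plus)

lemma convex_bessel_measures:
  assumes "finite_measure \<mu>" "sets \<mu> = sets borel"
  shows "convex_measure_set (bessel_measures B \<mu> p q)"
proof -
  have "frame_integral p q \<mu> (convex_comb_measure s \<nu>1 \<nu>2) f \<le> ennreal (B * Lp_norm p \<mu> f powr q)"
    if "\<nu>1 \<in> bessel_measures B \<mu> p q" "\<nu>2 \<in> bessel_measures B \<mu> p q" "0 \<le> s" "s \<le> 1"
      "f \<in> Lp_space p \<mu>" for \<nu>1 \<nu>2 s f
    using that assms
    by (subst ennreal_convex_comb_same[of s, symmetric])
       (auto simp: bessel_measures_iff frame_integral_convex_comb_measure
         intro!: add_mono mult_left_mono)
  then show ?thesis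
    by (auto simp: convex_measure_set_def bessel_measures_iff)
qed

lemma convex_frame_measures:
  assumes "finite_measure \<mu>" "sets \<mu> = sets borel"
  shows "convex_measure_set (frame_measures A B \<mu> p q)"
proof -
  have "ennreal (A * Lp_norm p \<mu> f powr q) \<le> frame_integral p q \<mu> (convex_comb_measure s \<nu>1 \<nu>2) f"
    if "\<nu>1 \<in> frame_measures A B \<mu> p q" "\<nu>2 \<in> frame_measures A B \<mu> p q" "0 \<le> s" "s \<le> 1"
      "f \<in> Lp_space p \<mu>" for \<nu>1 \<nu>2 s f
    using that assms
    by (subst ennreal_convex_comb_same[of s, symmetric])
       (auto simp: frame_measures_iff bessel_measures_iff frame_integral_convex_comb_measure
         intro!: add_mono mult_left_mono)
  then show ?thesis
    using convex_bessel_measures[OF assms]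
    by (auto simp: convex_measure_set_def frame_measures_iff)
qed

section \<open>Sigma-finiteness of Bessel measures\<close>

text \<open>
  The Fourier transform of \<open>\<mu>\<close> is continuous by dominated convergence, and its value at the
  origin is the total mass.
\<close>

lemma fourier_transform_nonzero_near_0:
  assumes "finite_measure \<mu>" and [measurable_cong]: "sets \<mu> = sets borel"
    and "measure \<mu> (space \<mu>) \<noteq> 0"
  obtains c r where "c > 0" "r > 0"
    "\<And>u :: real ^ 'd. norm u < r \<Longrightarrow> c \<le> norm (\<integral>x. expo u x \<partial>\<mu>)"
proof -
  interpret finite_measure \<mu> by fact
  define \<phi> where "\<phi> u = (\<integral>x. expo u x \<partial>\<mu>)" for u :: "real ^ 'd"
  define m where "m = measure \<mu> (space \<mu>)"
  have m: "m > 0"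
    using assms(3) by (simp add: m_def zero_less_measure_iff)
  have "isCont \<phi> 0"
    unfolding continuous_at_sequentially comp_def \<phi>_def
  proof (intro allI impI)
    fix X :: "nat \<Rightarrow> real ^ 'd" assume X: "X \<longlonglongrightarrow> 0"
    show "(\<lambda>n. \<integral>x. expo (X n) x \<partial>\<mu>) \<longlonglongrightarrow> (\<integral>x. expo 0 x \<partial>\<mu>)"
    proof (rule integral_dominated_convergence[where w = "\<lambda>_. 1"])
      show "AE x in \<mu>. (\<lambda>n. expo (X n) x) \<longlonglongrightarrow> expo 0 x"
        unfolding expo_def by (intro AE_I2 tendsto_intros X)
    qed (simp_all, measurable)
  qed
  then have "isCont (\<lambda>u. norm (\<phi> u)) 0"
    by (intro continuous_intros)
  then obtain r where r: "r > 0" "\<And>u. norm u < r \<Longrightarrow> \<bar>norm (\<phi> u) - norm (\<phi> 0)\<bar> < m / 2"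
    using m unfolding continuous_at_eps_delta dist_norm real_norm_def
    by (metis diff_zero half_gt_zero)
  have "norm (\<phi> 0) = m"
    by (simp add: \<phi>_def m_def)
  with r have "m / 2 \<le> norm (\<phi> u)" if "norm u < r" for u
    using r(2)[OF that] by linarith
  with m r(1) show thesis
    by (intro that[of "m / 2" r]) (auto simp: \<phi>_def)
qed

text \<open>
  The balls of radius \<open>r\<close> around a countable dense set already cover the space.
\<close>

lemma sigma_finite_if_uniform_balls_finite:
  fixes \<nu> :: "'a :: euclidean_space measure"
  assumes sets: "sets \<nu> = sets borel" and "r > 0"
    and fin: "\<And>s. emeasure \<nu> (ball s r) \<noteq> \<infinity>"
  shows "sigma_finite_measure \<nu>"
proof -
  obtain D :: "'a set" where D: "countable D"
      "\<And>X. open X \<Longrightarrow> X \<noteq> {} \<Longrightarrow> \<exists>d\<in>D. d \<in> X"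
    using countable_dense_setE by metis
  have "\<exists>d\<in>D. x \<in> ball d r" for x
    using D(2)[of "ball x r"] \<open>r > 0\<close> by (auto simp: dist_commute)
  moreover have "space \<nu> = UNIV"
    using sets sets_eq_imp_space_eq by fastforce
  ultimately have "(\<Union>d\<in>D. ball d r) = space \<nu>"
    by auto
  then show ?thesis
    using D(1) fin sets
    by (intro sigma_finite_measure.intro exI[of _ "(\<lambda>d. ball d r) ` D"]) auto
qed

text \<open>
  On a ball around \<open>s\<close> with a radius independent of \<open>s\<close>, the pairing \<open>[e\<^sub>s, e\<^sub>t]\<close> stays away
  from zero, so Markov's inequality and the Bessel bound for \<open>e\<^sub>s\<close> control the mass of that ball.
\<close>

lemma sigma_finite_bessel_measure:
  fixes \<mu> \<nu> :: "(real ^ 'd) measure"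
  assumes "finite_measure \<mu>" "sets \<mu> = sets borel" "measure \<mu> (space \<mu>) \<noteq> 0" "q > 0"
    and \<nu>: "\<nu> \<in> bessel_measures B \<mu> p q"
  shows "sigma_finite_measure \<nu>"
proof -
  obtain c r where c: "c > 0" and r: "r > 0"
    and cr: "\<And>u :: real ^ 'd. norm u < r \<Longrightarrow> c \<le> norm (\<integral>x. expo u x \<partial>\<mu>)"
    using fourier_transform_nonzero_near_0[OF assms(1-3)] by metis
  have sets: "sets \<nu> = sets borel"
    using \<nu> by (simp add: bessel_measures_iff)
  define N where "N = Lp_norm p \<mu> (expo 0)"
  have N: "N > 0"
    using assms(3) by (simp add: N_def Lp_norm_expo)
  define k where "k = (c / N powr (p - 2)) powr q"
  have k: "k > 0"
    using c N by (simp add: k_def)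
  have "emeasure \<nu> (ball s r) \<noteq> \<infinity>" for s
  proof -
    have low: "k \<le> norm (Lp_semi_inner p \<mu> (expo s) (expo t)) powr q" if "t \<in> ball s r" for t
    proof -
      have "Lp_semi_inner p \<mu> (expo s) (expo t)
          = complex_of_real (1 / N powr (p - 2)) * (\<integral>x. expo (s - t) x \<partial>\<mu>)"
        using N by (simp add: Lp_semi_inner_expo N_def flip: expo_add)
      then have "norm (Lp_semi_inner p \<mu> (expo s) (expo t))
          = norm (\<integral>x. expo (s - t) x \<partial>\<mu>) / N powr (p - 2)"
        by (simp add: norm_mult norm_divide)
      also have "\<dots> \<ge> c / N powr (p - 2)"
        using that by (intro divide_right_mono cr) (auto simp: dist_norm)
      finally show ?thesis
        unfolding k_def using c \<open>q > 0\<close> by (intro powr_mono2) auto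
    qed
    have "ennreal k * emeasure \<nu> (ball s r) = (\<integral>\<^sup>+ t. ennreal k * indicator (ball s r) t \<partial>\<nu>)"
      using sets by (simp add: nn_integral_cmult_indicator)
    also have "\<dots> \<le> frame_integral p q \<mu> \<nu> (expo s)"
      unfolding frame_integral_def
      by (intro nn_integral_mono) (auto simp: indicator_def intro: low ennreal_leI)
    also have "\<dots> < \<infinity>"
      using \<nu> expo_in_Lp_space[OF assms(1,2)] le_less_trans[OF _ ennreal_less_top]
      unfolding bessel_measures_iff infinity_ennreal_def by metis
    finally show ?thesis
      using k by (auto simp: ennreal_mult_eq_top_iff top_unique)
  qed
  then show ?thesis
    using sigma_finite_if_uniform_balls_finite sets r by blast
qed

section \<open>Convolution\<close>

lemma nn_integral_convolution_swap:
  fixes \<nu> \<rho> :: "'a :: ordered_euclidean_space measure"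
  assumes "sigma_finite_measure \<nu>" "sigma_finite_measure \<rho>"
    and [measurable_cong]: "sets \<nu> = sets borel" "sets \<rho> = sets borel"
    and [measurable]: "h \<in> borel_measurable borel"
  shows "(\<integral>\<^sup>+ z. h z \<partial>(\<nu> \<star> \<rho>)) = (\<integral>\<^sup>+ y. \<integral>\<^sup>+ x. h (x + y) \<partial>\<nu> \<partial>\<rho>)"
proof -
  interpret N: sigma_finite_measure \<nu> by fact
  interpret R: sigma_finite_measure \<rho> by fact
  interpret pair_sigma_finite \<nu> \<rho> ..
  have "(\<integral>\<^sup>+ z. h z \<partial>(\<nu> \<star> \<rho>)) = (\<integral>\<^sup>+ z. h (fst z + snd z) \<partial>(\<nu> \<Otimes>\<^sub>M \<rho>))"
    unfolding convolution_def
    by (subst nn_integral_distr) (simp_all add: case_prod_beta)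
  also have "\<dots> = (\<integral>\<^sup>+ y. \<integral>\<^sup>+ x. h (x + y) \<partial>\<nu> \<partial>\<rho>)"
    by (subst nn_integral_snd [symmetric]) (simp_all add: case_prod_beta)
  finally show ?thesis .
qed

text \<open>
  Tonelli's theorem combined with the shift identity for pairings with characters. The Bessel
  condition enters only to make \<open>\<nu>\<close> \<open>\<sigma>\<close>-finite; the equation itself yields both frame bounds.
\<close>

lemma frame_integral_convolution:
  fixes \<mu> \<nu> \<rho> :: "(real ^ 'd) measure"
  assumes \<mu>: "finite_measure \<mu>" "sets \<mu> = sets borel" and "q > 0"
    and \<nu>: "\<nu> \<in> bessel_measures B \<mu> p q"
    and \<rho>: "prob_space \<rho>" "sets \<rho> = sets borel"
    and f: "f \<in> Lp_space p \<mu>"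
  shows "frame_integral p q \<mu> (\<nu> \<star> \<rho>) f
    = (\<integral>\<^sup>+ y. frame_integral p q \<mu> \<nu> (\<lambda>x. f x * expo (- y) x) \<partial>\<rho>)"
proof (cases "measure \<mu> (space \<mu>) = 0")
  \<comment> \<open>Here \<open>\<nu>\<close> is arbitrary, but every \<open>[f, e\<^sub>t]\<close> is zero.\<close>
  case True
  then show ?thesis
    by (simp add: frame_integral_def Lp_semi_inner_expo Lp_norm_expo)
next
  case False
  interpret R: prob_space \<rho> by fact
  have "frame_integral p q \<mu> (\<nu> \<star> \<rho>) f =
    (\<integral>\<^sup>+ y. \<integral>\<^sup>+ t. ennreal (norm (Lp_semi_inner p \<mu> f (expo (t + y))) powr q) \<partial>\<nu> \<partial>\<rho>)"
    unfolding frame_integral_def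
  proof (rule nn_integral_convolution_swap)
    show "sigma_finite_measure \<nu>"
      using sigma_finite_bessel_measure[OF \<mu> False \<open>q > 0\<close> \<nu>] .
    show "sigma_finite_measure \<rho>" ..
  qed (use \<nu> \<rho> measurable_frame_integrand[OF \<mu> f] in \<open>auto simp: bessel_measures_iff\<close>)
  then show ?thesis
    by (simp add: frame_integral_def Lp_semi_inner_expo_add)
qed

lemma prob_convolution_bessel_measures:
  assumes \<mu>: "finite_measure \<mu>" "sets \<mu> = sets borel" and "q > 0"
  shows "closed_under_prob_convolution (bessel_measures B \<mu> p q)"
proof -
  have "frame_integral p q \<mu> (\<nu> \<star> \<rho>) f \<le> ennreal (B * Lp_norm p \<mu> f powr q)"
    if \<nu>: "\<nu> \<in> bessel_measures B \<mu> p q" and \<rho>: "prob_space \<rho>" "sets \<rho> = sets borel"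
      and f: "f \<in> Lp_space p \<mu>" for \<nu> \<rho> f
  proof -
    interpret R: prob_space \<rho> by fact
    have "frame_integral p q \<mu> \<nu> (\<lambda>x. f x * expo (- y) x) \<le> ennreal (B * Lp_norm p \<mu> f powr q)" for y
      using \<nu> Lp_space_modulate[OF \<mu>(2) f, of "- y"] Lp_norm_modulate[of p \<mu> f "- y"]
      unfolding bessel_measures_iff by metis
    then have "(\<integral>\<^sup>+ y. frame_integral p q \<mu> \<nu> (\<lambda>x. f x * expo (- y) x) \<partial>\<rho>)
        \<le> (\<integral>\<^sup>+ y. ennreal (B * Lp_norm p \<mu> f powr q) \<partial>\<rho>)"
      by (intro nn_integral_mono)
    then show ?thesis
      by (simp add: frame_integral_convolution[OF \<mu> \<open>q > 0\<close> \<nu> \<rho> f] R.emeasure_space_1)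
  qed
  then show ?thesis
    by (auto simp: closed_under_prob_convolution_def bessel_measures_iff)
qed

lemma prob_convolution_frame_measures:
  assumes \<mu>: "finite_measure \<mu>" "sets \<mu> = sets borel" and "q > 0"
  shows "closed_under_prob_convolution (frame_measures A B \<mu> p q)"
proof -
  have "ennreal (A * Lp_norm p \<mu> f powr q) \<le> frame_integral p q \<mu> (\<nu> \<star> \<rho>) f"
    if \<nu>: "\<nu> \<in> frame_measures A B \<mu> p q" and \<rho>: "prob_space \<rho>" "sets \<rho> = sets borel"
      and f: "f \<in> Lp_space p \<mu>" for \<nu> \<rho> f
  proof -
    interpret R: prob_space \<rho> by fact
    have "ennreal (A * Lp_norm p \<mu> f powr q) \<le> frame_integral p q \<mu> \<nu> (\<lambda>x. f x * expo (- y) x)" for y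
      using \<nu> Lp_space_modulate[OF \<mu>(2) f, of "- y"] Lp_norm_modulate[of p \<mu> f "- y"]
      unfolding frame_measures_iff by metis
    then have "(\<integral>\<^sup>+ y. ennreal (A * Lp_norm p \<mu> f powr q) \<partial>\<rho>)
        \<le> (\<integral>\<^sup>+ y. frame_integral p q \<mu> \<nu> (\<lambda>x. f x * expo (- y) x) \<partial>\<rho>)"
      by (intro nn_integral_mono)
    moreover have "\<nu> \<in> bessel_measures B \<mu> p q"
      using \<nu> by (simp add: frame_measures_iff)
    ultimately show ?thesis
      using frame_integral_convolution[OF \<mu> \<open>q > 0\<close> _ \<rho> f] by (simp add: R.emeasure_space_1)
  qed
  then show ?thesis
    using prob_convolution_bessel_measures[OF assms]
    by (auto simp: closed_under_prob_convolution_def frame_measures_iff)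
qed

theorem proposition4p3:
  fixes \<mu> :: "(real ^ 'd) measure" and A B p q :: real
  assumes "finite_measure \<mu>" and "sets \<mu> = sets borel"
    and "A > 0" and "B > 0"
    and "1 < p" and "1 < q" and "1 / p + 1 / q = 1"
  shows "convex_measure_set (bessel_measures B \<mu> p q)
    \<and> closed_under_prob_convolution (bessel_measures B \<mu> p q)
    \<and> convex_measure_set (frame_measures A B \<mu> p q)
    \<and> closed_under_prob_convolution (frame_measures A B \<mu> p q)"
  using assms
  by (simp add: convex_bessel_measures prob_convolution_bessel_measures
      convex_frame_measures prob_convolution_frame_measures)

end
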